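(* Let $f$ be an element of the energy space $\mathcal H=\mathcal H_E$ such that $f$ and $\Delta(f)$ are elements of $L^2(\mu)$. Then $$\|f\|_{\mathcal H}^2=\int_V f\,\Delta(f)\,d\mu.$$
   Context: $(V,\mathcal B,\mu)$ is a standard Borel space with a non-atomic infinite $\sigma$-finite measure $\mu$. $\rho$ is a $\sigma$-finite symmetric measure on $(V\times V,\mathcal B\times\mathcal B)$, i.e. $\rho(A\times B)=\rho(B\times A)$ for all $A,B\in\mathcal B$, supported by a symmetric Borel set $E\subset V\times V$, and disintegrated with respect to $\mu$: there is a measurable family $x\mapsto\rho_x$ of measures on $(V,\mathcal B)$, with $\rho_x$ supported by $E_x=\{y:(x,y)\in E\}$, such that $\iint f\,d\rho=\int_V\big(\int_V f(x,y)\,d\rho_x(y)\big)d\mu(x)$. The measure $\rho$ is irreducible: for $\mu$-a.e. $x$, $E_x$ is nonempty and uncountable and $(E_x,\rho_x)$ is a standard (non-atomic) measure space. Put $c(x)=\rho_x(V)$; it is assumed that $0<c(x)<\infty$ for $\mu$-a.e. $x$ and $\int_A c\,d\mu<\infty$ whenever $\mu(A)<\infty$. It is also assumed that, for every $A$ with $\mu(A)<\infty$, the function $x\mapsto\rho_x(A)$ belongs to $L^1(\mu)\cap L^2(\mu)$. The graph Laplace operator is $\Delta(f)(x)=\int_V(f(x)-f(y))\,d\rho_x(y)$. The finite energy space $\mathcal H_E$ consists of Borel functions $f:V\to\mathbb R$, modulo constants, with $\|f\|_{\mathcal H_E}^2=\frac12\iint_{V\times V}(f(x)-f(y))^2\,d\rho(x,y)<\infty$;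 "$f\in L^2(\mu)$" refers to the function (representative) $f$. *)

theory Defs
  imports "HOL-Analysis.Analysis"
begin

definition standard_borel :: "'a measure \<Rightarrow> bool" where
  "standard_borel M \<longleftrightarrow>
     (\<exists>X. completely_metrizable_space X \<and> second_countable X \<and>
          topspace X = space M \<and> sets M = sigma_sets (space M) {U. openin X U})"

definition nonatomic :: "'a measure \<Rightarrow> bool" where
  "nonatomic M \<longleftrightarrow>
     (\<forall>A\<in>sets M. 0 < emeasure M A \<longrightarrow>
        (\<exists>B\<in>sets M. B \<subseteq> A \<and> 0 < emeasure M B \<and> emeasure M B < emeasure M A))"

definition standard_measure_space :: "'a measure \<Rightarrow> bool" where
  "standard_measure_space M \<longleftrightarrow> standard_borel M \<and> sigma_finite_measure M \<and> nonatomic M"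

text \<open>
  Membership in \<open>L\<^sup>2\<close> must depend only on the values almost everywhere, also for
  functions such as the Laplacian below, which are defined only up to a null set.
  Measurability and integrals are therefore taken with respect to the completion; for a
  function that is Borel measurable this is the same as using \<open>M\<close> itself
  (\<open>integrable_completion\<close>, \<open>integral_completion\<close>).
\<close>

definition square_integrable :: "'a measure \<Rightarrow> ('a \<Rightarrow> real) \<Rightarrow> bool" where
  "square_integrable M f \<longleftrightarrow>
     f \<in> borel_measurable (completion M) \<and> integrable (completion M) (\<lambda>x. (f x)\<^sup>2)"

text \<open>
  In the following locale \<open>M\<close> is \<open>(V, \<B>, \<mu>)\<close>, \<open>\<rho>\<close> is the symmetric measure on
  \<open>V \<times> V\<close>, supported by \<open>E\<close>, and \<open>K x\<close> is the fibre measure \<open>\<rho>\<^sub>x\<close>, so that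
  \<open>c(x) = emeasure (K x) (space M)\<close>.
\<close>

locale graph_measure_space =
  fixes M :: "'a measure"
    and \<rho> :: "('a \<times> 'a) measure"
    and E :: "('a \<times> 'a) set"
    and K :: "'a \<Rightarrow> 'a measure"
  assumes standard_M: "standard_measure_space M"
    and infinite_M: "emeasure M (space M) = \<infinity>"
    and sets_rho: "sets \<rho> = sets (M \<Otimes>\<^sub>M M)"
    and sigma_finite_rho: "sigma_finite_measure \<rho>"
    and symmetric_rho:
      "\<And>A B. A \<in> sets M \<Longrightarrow> B \<in> sets M \<Longrightarrow> emeasure \<rho> (A \<times> B) = emeasure \<rho> (B \<times> A)"
    and sets_E: "E \<in> sets (M \<Otimes>\<^sub>M M)"
    and sym_E: "sym E"
    and supported_rho: "emeasure \<rho> (space \<rho> - E) = 0"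
    and sets_K: "\<And>x. x \<in> space M \<Longrightarrow> sets (K x) = sets M"
    and measurable_K: "\<And>A. A \<in> sets M \<Longrightarrow> (\<lambda>x. emeasure (K x) A) \<in> borel_measurable M"
    and supported_K: "\<And>x. x \<in> space M \<Longrightarrow> emeasure (K x) (space M - E `` {x}) = 0"
    and disintegration:
      "\<And>g :: 'a \<times> 'a \<Rightarrow> ennreal. g \<in> borel_measurable (M \<Otimes>\<^sub>M M) \<Longrightarrow>
         (\<integral>\<^sup>+ p. g p \<partial>\<rho>) = (\<integral>\<^sup>+ x. (\<integral>\<^sup>+ y. g (x, y) \<partial>K x) \<partial>M)"
    and irreducible:
      "AE x in M. E `` {x} \<noteq> {} \<and> uncountable (E `` {x}) \<and>
         standard_measure_space (restrict_space (K x) (E `` {x}))"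
    and c_pos_finite:
      "AE x in M. 0 < emeasure (K x) (space M) \<and> emeasure (K x) (space M) < \<infinity>"
    and c_locally_integrable:
      "\<And>A. A \<in> sets M \<Longrightarrow> emeasure M A < \<infinity> \<Longrightarrow>
         (\<integral>\<^sup>+ x\<in>A. emeasure (K x) (space M) \<partial>M) < \<infinity>"
    and K_L1_L2:
      "\<And>A. A \<in> sets M \<Longrightarrow> emeasure M A < \<infinity> \<Longrightarrow>
         integrable M (\<lambda>x. measure (K x) A) \<and> square_integrable M (\<lambda>x. measure (K x) A)"

text \<open>
  For \<open>f\<close> of finite energy the integrand below is \<open>K x\<close>-integrable for almost every
  \<open>x\<close>; elsewhere the Bochner integral is \<open>0\<close> by convention.
\<close>

definition graph_laplacian :: "('a \<Rightarrow> 'a measure) \<Rightarrow> ('a \<Rightarrow> real) \<Rightarrow> 'a \<Rightarrow> real" where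
  "graph_laplacian K f x = (\<integral> y. f x - f y \<partial>K x)"

text \<open>
  Elements of the energy space are classes of functions modulo constants. Here they are
  given by representatives; adding a constant changes neither membership nor norm.
\<close>

definition energy_space :: "'a measure \<Rightarrow> ('a \<times> 'a) measure \<Rightarrow> ('a \<Rightarrow> real) set" where
  "energy_space M \<rho> =
     {f \<in> borel_measurable M. (\<integral>\<^sup>+ (x, y). ennreal ((f x - f y)\<^sup>2) \<partial>\<rho>) < \<infinity>}"

definition energy_norm :: "('a \<times> 'a) measure \<Rightarrow> ('a \<Rightarrow> real) \<Rightarrow> real" where
  "energy_norm \<rho> f = sqrt ((1 / 2) * (\<integral> (x, y). (f x - f y)\<^sup>2 \<partial>\<rho>))"

end

theory Submission
  imports Defs "HOL-Probability.Giry_Monad"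
begin

text \<open>
  The identity is Green's formula
  \<open>\<integral> \<phi> \<Delta>f d\<mu> = \<integral>\<integral> \<phi>(x) (f x - f y) d\<rho> = 1/2 \<integral>\<integral> (\<phi>(x) - \<phi>(y)) (f x - f y) d\<rho>\<close>
  for \<open>\<phi> = f\<close>; the first equality is the disintegration of \<open>\<rho>\<close> and the second
  its symmetry. For \<open>\<phi> = f\<close> the middle integral need not converge absolutely, because
  \<open>f \<in> L\<^sup>2(\<mu>)\<close> does not give \<open>f \<in> L\<^sup>2(c \<mu>)\<close> when \<open>c\<close> is unbounded.

  So the formula is first applied to \<open>\<phi>\<^sub>n = T\<^sub>n \<circ> f\<close>, where \<open>T\<^sub>n\<close> is a
  1-Lipschitz function on the line that is bounded by \<open>n\<close>, vanishes on
  \<open>[-1/n, 1/n]\<close> and converges pointwise to the identity. The set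
  \<open>{\<bar>f\<bar> > 1/n}\<close> has finite \<open>\<mu>\<close>-measure since \<open>f \<in> L\<^sup>2(\<mu>)\<close>, hence finite
  \<open>c \<mu>\<close>-measure by local integrability of \<open>c\<close>; therefore
  \<open>\<phi>\<^sub>n \<in> L\<^sup>2(c \<mu>)\<close> and the middle integral converges absolutely. The passage to the
  limit is dominated on both sides: \<open>\<bar>T\<^sub>n t\<bar> \<le> \<bar>t\<bar>\<close> gives the bound
  \<open>\<bar>f \<Delta>f\<bar>\<close>, which is integrable as a product of two \<open>L\<^sup>2\<close> functions, and the
  Lipschitz property gives the bound \<open>(f x - f y)\<^sup>2\<close>, which is integrable as \<open>f\<close>
  has finite energy.
\<close>

section \<open>A truncation of the real line\<close>

text \<open>
  The difference of the projections of the line onto \<open>[-b, b]\<close> and onto \<open>[-a, a]\<close>.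
  For \<open>0 \<le> a \<le> b\<close> both have slope one on \<open>[-a, a]\<close>, where they cancel; between
  \<open>a\<close> and \<open>b\<close> in absolute value only the first has slope one, and beyond \<open>b\<close>
  neither moves. So the difference is 1-Lipschitz.
\<close>

definition truncation :: "real \<Rightarrow> real \<Rightarrow> real \<Rightarrow> real" where
  "truncation a b t = max (- b) (min b t) - max (- a) (min a t)"

lemma borel_measurable_truncation [measurable]: "truncation a b \<in> borel_measurable borel"
  unfolding truncation_def[abs_def] by measurable

lemma truncation_eq_0: "a \<le> b \<Longrightarrow> \<bar>t\<bar> \<le> a \<Longrightarrow> truncation a b t = 0"
  by (auto simp: truncation_def max_def min_def)

lemma abs_truncation_le: "0 \<le> a \<Longrightarrow> a \<le> b \<Longrightarrow> \<bar>truncation a b t\<bar> \<le> b"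
  by (auto simp: truncation_def max_def min_def)

lemma truncation_lipschitz:
  "0 \<le> a \<Longrightarrow> a \<le> b \<Longrightarrow> \<bar>truncation a b s - truncation a b t\<bar> \<le> \<bar>s - t\<bar>"
  by (auto simp: truncation_def max_def min_def)

lemma abs_truncation_le_abs: "0 \<le> a \<Longrightarrow> a \<le> b \<Longrightarrow> \<bar>truncation a b t\<bar> \<le> \<bar>t\<bar>"
  using truncation_lipschitz[of a b t 0] by (simp add: truncation_eq_0)

lemma truncation_tendsto:
  assumes a: "(a \<longlongrightarrow> 0) F" and b: "filterlim b at_top F"
  shows "((\<lambda>n. truncation (a n) (b n) t) \<longlongrightarrow> t) F"
proof -
  have "\<forall>\<^sub>F n in F. \<bar>t\<bar> \<le> b n"
    using b by (simp add: filterlim_at_top)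
  then have "\<forall>\<^sub>F n in F. t = max (- b n) (min (b n) t)"
    by eventually_elim auto
  then have "((\<lambda>n. max (- b n) (min (b n) t)) \<longlongrightarrow> t) F"
    by (rule tendsto_eventually[OF eventually_mono]) simp
  moreover have "((\<lambda>n. max (- a n) (min (a n) t)) \<longlongrightarrow> max (- 0) (min 0 t)) F"
    by (intro tendsto_intros a)
  ultimately show ?thesis
    unfolding truncation_def by (auto dest: tendsto_diff)
qed

section \<open>Disintegration and symmetry for real integrands\<close>

lemma integral_enn2real:
  assumes [measurable]: "a \<in> borel_measurable N" and fin: "(\<integral>\<^sup>+ x. a x \<partial>N) < \<infinity>"
  shows "integrable N (\<lambda>x. enn2real (a x))"
    and "(\<integral> x. enn2real (a x) \<partial>N) = enn2real (\<integral>\<^sup>+ x. a x \<partial>N)"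
proof -
  have "AE x in N. a x \<noteq> \<infinity>"
    using fin by (intro nn_integral_PInf_AE) auto
  then have "AE x in N. ennreal (enn2real (a x)) = a x"
    by eventually_elim (simp add: less_top)
  then have eq: "(\<integral>\<^sup>+ x. ennreal (enn2real (a x)) \<partial>N) = (\<integral>\<^sup>+ x. a x \<partial>N)"
    by (rule nn_integral_cong_AE)
  show "integrable N (\<lambda>x. enn2real (a x))"
    using fin by (intro integrableI_nonneg) (auto simp: eq)
  show "(\<integral> x. enn2real (a x) \<partial>N) = enn2real (\<integral>\<^sup>+ x. a x \<partial>N)"
    by (subst integral_eq_nn_integral) (auto simp: eq)
qed

lemma integrable_mult_of_square:
  fixes u v :: "'a \<Rightarrow> real"
  assumes [measurable]: "u \<in> borel_measurable N" "v \<in> borel_measurable N"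
    and "integrable N (\<lambda>x. (u x)\<^sup>2)" "integrable N (\<lambda>x. (v x)\<^sup>2)"
  shows "integrable N (\<lambda>x. u x * v x)"
proof -
  have "\<bar>r * s\<bar> \<le> r\<^sup>2 + s\<^sup>2" for r s :: real
    using sum_squares_bound[of "\<bar>r\<bar>" "\<bar>s\<bar>"] abs_ge_zero[of "r * s"]
    unfolding abs_mult power2_abs by linarith
  moreover have "integrable N (\<lambda>x. (u x)\<^sup>2 + (v x)\<^sup>2)"
    using assms by (intro Bochner_Integration.integrable_add)
  ultimately show ?thesis
    by (rule_tac Bochner_Integration.integrable_bound[where f = "\<lambda>x. (u x)\<^sup>2 + (v x)\<^sup>2"]) auto
qed

lemma measurable_swap [measurable]: "prod.swap \<in> measurable (M \<Otimes>\<^sub>M N) (N \<Otimes>\<^sub>M M)"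
  by (simp add: prod.swap_def[abs_def])

context graph_measure_space
begin

lemma measurable_rho_eq [simp]: "measurable \<rho> N = measurable (M \<Otimes>\<^sub>M M) N"
  by (rule measurable_cong_sets[OF sets_rho refl])

lemma space_rho: "space \<rho> = space M \<times> space M"
  using sets_eq_imp_space_eq[OF sets_rho] by (simp add: space_pair_measure)

lemma sigma_finite_M: "sigma_finite_measure M"
  using standard_M by (simp add: standard_measure_space_def)

text \<open>
  Almost every fibre measure is finite, so after normalisation and a modification on a null
  set the fibre measures form a kernel of subprobabilities, for which measurability of
  parametrised integrals is known.
\<close>

lemma nn_integral_fibre_AE_measurable:
  assumes g [measurable]: "g \<in> borel_measurable (M \<Otimes>\<^sub>M M)"
  shows "\<exists>a\<in>borel_measurable M. AE x in M. (\<integral>\<^sup>+ y. g (x, y) \<partial>K x) = a x"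
proof -
  define c where "c x = emeasure (K x) (space M)" for x
  define P where "P x \<longleftrightarrow> 0 < c x \<and> c x < \<infinity>" for x
  define L where "L x = (if P x then scale_measure (inverse (c x)) (K x) else null_measure M)" for x
  have c [measurable]: "c \<in> borel_measurable M"
    unfolding c_def[abs_def] by (rule measurable_K) simp
  have P [measurable]: "Measurable.pred M P"
    unfolding P_def[abs_def] by measurable
  have inv: "c x * inverse (c x) = 1" if "P x" for x
    using that ennreal_divide_self[of "c x"] by (auto simp: P_def divide_ennreal_def)
  have ne: "space M \<noteq> {}"
    using infinite_M by auto
  have "L \<in> measurable M (subprob_algebra M)"
  proof (rule measurable_subprob_algebra)
    fix x assume x: "x \<in> space M"
    show sets_L: "sets (L x) = sets M"
      by (simp add: L_def sets_K[OF x])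
    have space_L: "space (L x) = space M"
      using sets_L by (rule sets_eq_imp_space_eq)
    have "emeasure (L x) (space M) = (if P x then c x * inverse (c x) else 0)"
      by (simp add: L_def c_def mult.commute)
    then show "subprob_space (L x)"
      using ne space_L by (intro subprob_spaceI) (auto simp: inv)
  next
    fix A assume [measurable]: "A \<in> sets M"
    have [measurable]: "(\<lambda>x. emeasure (K x) A) \<in> borel_measurable M"
      by (rule measurable_K) fact
    have "(\<lambda>x. emeasure (L x) A)
        = (\<lambda>x. if P x then inverse (c x) * emeasure (K x) A else 0)"
      by (auto simp: L_def)
    also have "\<dots> \<in> borel_measurable M" by measurable
    finally show "(\<lambda>x. emeasure (L x) A) \<in> borel_measurable M" .
  qed
  then have [measurable]: "(\<lambda>x. \<integral>\<^sup>+ y. g (x, y) \<partial>L x) \<in> borel_measurable M"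
    by (intro nn_integral_measurable_subprob_algebra2[where N = M]) auto
  have "AE x in M. P x"
    using c_pos_finite by (simp add: P_def c_def)
  then have "AE x in M. (\<integral>\<^sup>+ y. g (x, y) \<partial>K x) = c x * (\<integral>\<^sup>+ y. g (x, y) \<partial>L x)"
  proof (rule AE_mp, intro AE_I2 impI)
    fix x assume x: "x \<in> space M" and Px: "P x"
    have "(\<lambda>y. g (x, y)) \<in> borel_measurable M"
      using x by measurable
    then have "(\<lambda>y. g (x, y)) \<in> borel_measurable (K x)"
      by (simp add: measurable_cong_sets[OF sets_K[OF x] refl])
    then have "c x * (\<integral>\<^sup>+ y. g (x, y) \<partial>L x) = c x * inverse (c x) * (\<integral>\<^sup>+ y. g (x, y) \<partial>K x)"
      using Px by (simp add: L_def nn_integral_scale_measure mult.assoc)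
    then show "(\<integral>\<^sup>+ y. g (x, y) \<partial>K x) = c x * (\<integral>\<^sup>+ y. g (x, y) \<partial>L x)"
      by (simp add: inv[OF Px])
  qed
  then show ?thesis
    by (intro bexI[of _ "\<lambda>x. c x * (\<integral>\<^sup>+ y. g (x, y) \<partial>L x)"]) auto
qed

text \<open>
  The fibre integral of a real function differs from a Borel function on a null set that need
  not be Borel, hence the integral with respect to the completion.
\<close>

lemma integral_disintegration:
  fixes h :: "'a \<times> 'a \<Rightarrow> real"
  assumes h: "integrable \<rho> h"
    and meas: "(\<lambda>x. \<integral> y. h (x, y) \<partial>K x) \<in> borel_measurable (completion M)"
  shows "(\<integral> x. (\<integral> y. h (x, y) \<partial>K x) \<partial>completion M) = (\<integral> p. h p \<partial>\<rho>)"
proof -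
  have hm [measurable]: "h \<in> borel_measurable (M \<Otimes>\<^sub>M M)"
    using borel_measurable_integrable[OF h] by simp
  obtain a where a [measurable]: "a \<in> borel_measurable M"
    and ae_a: "AE x in M. (\<integral>\<^sup>+ y. ennreal (h (x, y)) \<partial>K x) = a x"
    using nn_integral_fibre_AE_measurable[of "\<lambda>p. ennreal (h p)"] by auto
  obtain b where b [measurable]: "b \<in> borel_measurable M"
    and ae_b: "AE x in M. (\<integral>\<^sup>+ y. ennreal (- h (x, y)) \<partial>K x) = b x"
    using nn_integral_fibre_AE_measurable[of "\<lambda>p. ennreal (- h p)"] by auto
  have int_a: "(\<integral>\<^sup>+ x. a x \<partial>M) = (\<integral>\<^sup>+ p. ennreal (h p) \<partial>\<rho>)"
    by (subst disintegration) (auto intro!: nn_integral_cong_AE simp: ae_a[THEN AE_symmetric])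
  have int_b: "(\<integral>\<^sup>+ x. b x \<partial>M) = (\<integral>\<^sup>+ p. ennreal (- h p) \<partial>\<rho>)"
    by (subst disintegration) (auto intro!: nn_integral_cong_AE simp: ae_b[THEN AE_symmetric])
  have fin_a: "(\<integral>\<^sup>+ x. a x \<partial>M) < \<infinity>" and fin_b: "(\<integral>\<^sup>+ x. b x \<partial>M) < \<infinity>"
    using h by (auto simp: int_a int_b real_integrable_def less_top)
  have "AE x in M. a x \<noteq> \<infinity>" "AE x in M. b x \<noteq> \<infinity>"
    using fin_a fin_b nn_integral_PInf_AE[of a M] nn_integral_PInf_AE[of b M] by auto
  with ae_a ae_b AE_space
  have ae: "AE x in M. (\<integral> y. h (x, y) \<partial>K x) = enn2real (a x) - enn2real (b x)"
  proof eventually_elim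
    case (elim x)
    have "(\<lambda>y. h (x, y)) \<in> borel_measurable M"
      using elim by measurable
    then have "(\<lambda>y. h (x, y)) \<in> borel_measurable (K x)"
      using elim by (simp add: measurable_cong_sets[OF sets_K refl])
    with elim have "integrable (K x) (\<lambda>y. h (x, y))"
      by (simp add: real_integrable_def)
    then show ?case
      using elim by (simp add: real_lebesgue_integral_def)
  qed
  have "(\<integral> x. (\<integral> y. h (x, y) \<partial>K x) \<partial>completion M)
      = (\<integral> x. enn2real (a x) - enn2real (b x) \<partial>completion M)"
    using meas AE_completion[OF ae]
    by (intro integral_cong_AE) (auto intro: measurable_completion)
  also have "\<dots> = (\<integral> x. enn2real (a x) - enn2real (b x) \<partial>M)"
    by (rule integral_completion) simp
  also have "\<dots> = enn2real (\<integral>\<^sup>+ x. a x \<partial>M) - enn2real (\<integral>\<^sup>+ x. b x \<partial>M)"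
    using fin_a fin_b integral_enn2real[OF a] integral_enn2real[OF b] by simp
  also have "\<dots> = (\<integral> p. h p \<partial>\<rho>)"
    by (simp add: int_a int_b real_lebesgue_integral_def[OF h])
  finally show ?thesis .
qed

lemma rho_times_space:
  assumes [measurable]: "A \<in> sets M"
  shows "emeasure \<rho> (A \<times> space M) = (\<integral>\<^sup>+ x\<in>A. emeasure (K x) (space M) \<partial>M)"
proof -
  have "emeasure \<rho> (A \<times> space M) = (\<integral>\<^sup>+ p. indicator (A \<times> space M) p \<partial>\<rho>)"
    by (simp add: sets_rho)
  also have "\<dots> = (\<integral>\<^sup>+ x. (\<integral>\<^sup>+ y. indicator (A \<times> space M) (x, y) \<partial>K x) \<partial>M)"
    by (rule disintegration) simp
  also have "\<dots> = (\<integral>\<^sup>+ x\<in>A. emeasure (K x) (space M) \<partial>M)"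
  proof (rule nn_integral_cong)
    fix x assume "x \<in> space M"
    then have "space M \<in> sets (K x)" by (simp add: sets_K)
    then show "(\<integral>\<^sup>+ y. indicator (A \<times> space M) (x, y) \<partial>K x)
        = emeasure (K x) (space M) * indicator A x"
      by (simp add: indicator_times nn_integral_cmult_indicator mult.commute)
  qed
  finally show ?thesis .
qed

text \<open>
  Symmetry on rectangles determines the flipped measure, because \<open>V \<times> V\<close> is covered by the
  rectangles \<open>A\<^sub>n \<times> V\<close> with \<open>\<mu>(A\<^sub>n) < \<infinity>\<close>, whose \<open>\<rho>\<close>-measure
  \<open>\<integral>\<^bsub>A\<^sub>n\<^esub> c d\<mu>\<close> is finite.
\<close>

lemma distr_swap_rho: "distr \<rho> (M \<Otimes>\<^sub>M M) prod.swap = \<rho>"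
proof -
  interpret M: sigma_finite_measure M by (rule sigma_finite_M)
  obtain A :: "nat \<Rightarrow> 'a set" where A: "range A \<subseteq> sets M" "(\<Union>i. A i) = space M"
    "\<And>i. emeasure M (A i) \<noteq> \<infinity>"
    using M.sigma_finite by blast
  have "\<rho> = distr \<rho> (M \<Otimes>\<^sub>M M) prod.swap"
  proof (rule measure_eqI_generator_eq[OF Int_stable_pair_measure_generator[of M M],
        where A = "\<lambda>i. A i \<times> space M"])
    show "{a \<times> b |a b. a \<in> sets M \<and> b \<in> sets M} \<subseteq> Pow (space M \<times> space M)"
      by (rule pair_measure_closed)
    fix X assume "X \<in> {a \<times> b |a b. a \<in> sets M \<and> b \<in> sets M}"
    then obtain B C where X: "X = B \<times> C" and [measurable]: "B \<in> sets M" "C \<in> sets M"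
      by auto
    have "prod.swap -` X \<inter> space \<rho> = C \<times> B"
      using sets.sets_into_space[of B M] sets.sets_into_space[of C M] by (auto simp: X space_rho)
    then show "emeasure \<rho> X = emeasure (distr \<rho> (M \<Otimes>\<^sub>M M) prod.swap) X"
      by (simp add: emeasure_distr X symmetric_rho)
  next
    show "emeasure \<rho> (A i \<times> space M) \<noteq> \<infinity>" for i
      using A c_locally_integrable[of "A i"] by (subst rho_times_space) (auto simp: less_top)
  qed (use A in \<open>auto simp: sets_rho sets_pair_measure\<close>)
  then show ?thesis by simp
qed

lemma integrable_rho_swap:
  fixes h :: "'a \<times> 'a \<Rightarrow> real"
  assumes "integrable \<rho> h"
  shows "integrable \<rho> (\<lambda>p. h (prod.swap p))"
    and "(\<integral> p. h (prod.swap p) \<partial>\<rho>) = (\<integral> p. h p \<partial>\<rho>)"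
proof -
  have [measurable]: "h \<in> borel_measurable (M \<Otimes>\<^sub>M M)"
    using borel_measurable_integrable[OF assms] by simp
  show "integrable \<rho> (\<lambda>p. h (prod.swap p))"
    using assms by (subst (asm) distr_swap_rho[symmetric]) (simp add: integrable_distr_eq)
  show "(\<integral> p. h (prod.swap p) \<partial>\<rho>) = (\<integral> p. h p \<partial>\<rho>)"
    by (subst (2) distr_swap_rho[symmetric]) (simp add: integral_distr)
qed

section \<open>Green's formula\<close>

lemma energy_spaceD:
  assumes "f \<in> energy_space M \<rho>"
  shows "f \<in> borel_measurable M"
    and "integrable \<rho> (\<lambda>p. (f (fst p) - f (snd p))\<^sup>2)"
proof -
  show [measurable]: "f \<in> borel_measurable M"
    using assms by (simp add: energy_space_def)
  show "integrable \<rho> (\<lambda>p. (f (fst p) - f (snd p))\<^sup>2)"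
    using assms by (intro integrableI_nonneg) (auto simp: energy_space_def split_beta')
qed

text \<open>
  Square integrability of \<open>\<phi>\<close> with respect to \<open>c \<mu>\<close>, which is the marginal of
  \<open>\<rho>\<close>, makes \<open>\<phi>(x) (f x - f y)\<close> integrable as a product of two functions in
  \<open>L\<^sup>2(\<rho>)\<close>.
\<close>

lemma green_formula:
  assumes f: "f \<in> energy_space M \<rho>"
    and lap: "graph_laplacian K f \<in> borel_measurable (completion M)"
    and \<phi> [measurable]: "\<phi> \<in> borel_measurable M"
    and sq: "integrable \<rho> (\<lambda>p. (\<phi> (fst p))\<^sup>2)"
  shows "(\<integral> x. \<phi> x * graph_laplacian K f x \<partial>completion M)
      = (1 / 2) * (\<integral> (x, y). (\<phi> x - \<phi> y) * (f x - f y) \<partial>\<rho>)"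
proof -
  note [measurable] = energy_spaceD(1)[OF f]
  define h where "h p = \<phi> (fst p) * (f (fst p) - f (snd p))" for p
  have [measurable]: "h \<in> borel_measurable (M \<Otimes>\<^sub>M M)"
    unfolding h_def[abs_def] by measurable
  have h: "integrable \<rho> h"
    unfolding h_def[abs_def] using sq energy_spaceD(2)[OF f] by (intro integrable_mult_of_square) auto
  have fibre: "(\<integral> y. h (x, y) \<partial>K x) = \<phi> x * graph_laplacian K f x" for x
    by (simp add: h_def graph_laplacian_def)
  have "(\<integral> x. \<phi> x * graph_laplacian K f x \<partial>completion M) = (\<integral> p. h p \<partial>\<rho>)"
    using integral_disintegration[OF h] lap measurable_completion[OF \<phi>]
    by (simp add: fibre)
  also have "\<dots> = (1 / 2) * ((\<integral> p. h p \<partial>\<rho>) + (\<integral> p. h (prod.swap p) \<partial>\<rho>))"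
    by (simp add: integrable_rho_swap(2)[OF h])
  also have "\<dots> = (1 / 2) * (\<integral> p. h p + h (prod.swap p) \<partial>\<rho>)"
    by (subst Bochner_Integration.integral_add) (auto intro: h integrable_rho_swap)
  also have "(\<lambda>p. h p + h (prod.swap p)) = (\<lambda>(x, y). (\<phi> x - \<phi> y) * (f x - f y))"
    by (auto simp: h_def fun_eq_iff algebra_simps)
  finally show ?thesis .
qed

text \<open>
  A bounded function that vanishes outside a set of finite \<open>\<mu>\<close>-measure lies in
  \<open>L\<^sup>2(c \<mu>)\<close>, because \<open>c\<close> is integrable over that set.
\<close>

lemma square_integrable_rho_fst:
  fixes \<phi> :: "'a \<Rightarrow> real"
  assumes [measurable]: "\<phi> \<in> borel_measurable M" "A \<in> sets M"
    and A: "emeasure M A < \<infinity>"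
    and bound: "\<And>x. x \<in> space M \<Longrightarrow> \<bar>\<phi> x\<bar> \<le> B * indicator A x"
  shows "integrable \<rho> (\<lambda>p. (\<phi> (fst p))\<^sup>2)"
proof -
  have "emeasure \<rho> (A \<times> space M) < \<infinity>"
    using c_locally_integrable[OF _ A] by (simp add: rho_times_space)
  then have int: "integrable \<rho> (\<lambda>p. B\<^sup>2 * indicator (A \<times> space M) p)"
    by (intro integrable_mult_right integrable_real_indicator) (auto simp: sets_rho)
  have "(\<phi> x)\<^sup>2 \<le> B\<^sup>2 * indicator A x" if "x \<in> space M" for x
    using bound[OF that] by (cases "x \<in> A") (auto simp: abs_le_square_iff[symmetric])
  then show ?thesis
    by (intro Bochner_Integration.integrable_bound[OF int])
       (auto simp: space_rho indicator_times)
qed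

lemma finite_measure_superlevel:
  assumes [measurable]: "f \<in> borel_measurable M"
    and sq: "square_integrable M f" and a: "0 < a"
  shows "emeasure M {x \<in> space M. a < \<bar>f x\<bar>} < \<infinity>"
proof -
  have "integrable M (\<lambda>x. (f x)\<^sup>2)"
    using sq by (simp add: square_integrable_def integrable_completion)
  then have "emeasure M {x \<in> space M. a\<^sup>2 \<le> (f x)\<^sup>2} \<le> ennreal ((1 / a\<^sup>2) * (\<integral> x. (f x)\<^sup>2 \<partial>M))"
    using a by (intro integral_Markov_inequality) auto
  also have "\<dots> < \<infinity>" by simp
  finally have "emeasure M {x \<in> space M. a\<^sup>2 \<le> (f x)\<^sup>2} < \<infinity>" .
  moreover have "{x \<in> space M. a < \<bar>f x\<bar>} \<subseteq> {x \<in> space M. a\<^sup>2 \<le> (f x)\<^sup>2}"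
    using a by (auto simp: abs_le_square_iff[symmetric])
  ultimately show ?thesis
    by (rule le_less_trans[OF emeasure_mono, rotated 2]) measurable
qed

end

theorem theorem7p5:
  fixes M :: "'a measure" and \<rho> :: "('a \<times> 'a) measure"
    and E :: "('a \<times> 'a) set" and K :: "'a \<Rightarrow> 'a measure"
    and f :: "'a \<Rightarrow> real"
  assumes "graph_measure_space M \<rho> E K"
    and "f \<in> energy_space M \<rho>"
    and "square_integrable M f"
    and "square_integrable M (graph_laplacian K f)"
  shows "(energy_norm \<rho> f)\<^sup>2 = (\<integral> x. f x * graph_laplacian K f x \<partial>completion M)"
proof -
  interpret graph_measure_space M \<rho> E K by fact
  let ?L = "graph_laplacian K f"
  note f [measurable] = energy_spaceD(1)[OF assms(2)]
  have fc [measurable]: "f \<in> borel_measurable (completion M)"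
    by (rule measurable_completion) fact
  have L [measurable]: "?L \<in> borel_measurable (completion M)"
    using assms(4) by (simp add: square_integrable_def)
  define a where "a n = inverse (real (Suc n))" for n
  define b where "b n = real (Suc n)" for n
  define \<phi> where "\<phi> n x = truncation (a n) (b n) (f x)" for n x
  have a0: "0 < a n" and a0': "0 \<le> a n" and ab: "a n \<le> b n" for n
    using le_imp_inverse_le[of 1 "real (Suc n)"] by (auto simp: a_def b_def)
  have lim: "(\<lambda>n. \<phi> n x) \<longlonglongrightarrow> f x" for x
    unfolding \<phi>_def
  proof (rule truncation_tendsto)
    show "a \<longlonglongrightarrow> 0"
      unfolding a_def[abs_def] by (rule LIMSEQ_inverse_real_of_nat)
    show "filterlim b at_top sequentially"
      unfolding b_def[abs_def]
      by (rule filterlim_compose[OF filterlim_real_sequentially filterlim_Suc])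
  qed
  have \<phi> [measurable]: "\<phi> n \<in> borel_measurable M" for n
    unfolding \<phi>_def[abs_def] by measurable
  have \<phi>c [measurable]: "\<phi> n \<in> borel_measurable (completion M)" for n
    by (rule measurable_completion) (rule \<phi>)
  \<comment> \<open>\<open>\<phi> n\<close> vanishes off \<open>{\<bar>f\<bar> > 1/(n+1)}\<close>, a set of finite measure as \<open>f \<in> L\<^sup>2(\<mu>)\<close>.\<close>
  have green: "(\<integral> x. \<phi> n x * ?L x \<partial>completion M)
      = (1 / 2) * (\<integral> (x, y). (\<phi> n x - \<phi> n y) * (f x - f y) \<partial>\<rho>)" for n
  proof (rule green_formula[OF assms(2) L \<phi>])
    show "integrable \<rho> (\<lambda>p. (\<phi> n (fst p))\<^sup>2)"
    proof (rule square_integrable_rho_fst[OF \<phi> _ finite_measure_superlevel[OF f assms(3) a0]])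
      show "\<bar>\<phi> n x\<bar> \<le> b n * indicator {x \<in> space M. a n < \<bar>f x\<bar>} x" if "x \<in> space M" for x
        using that abs_truncation_le[OF a0' ab, of n "f x"] truncation_eq_0[OF ab, of "f x" n]
        by (auto simp: \<phi>_def indicator_def not_less)
    qed measurable
  qed
  have "(\<lambda>n. \<integral> x. \<phi> n x * ?L x \<partial>completion M)
      \<longlonglongrightarrow> (\<integral> x. f x * ?L x \<partial>completion M)"
  proof (rule integral_dominated_convergence[where w = "\<lambda>x. \<bar>f x * ?L x\<bar>"])
    show "integrable (completion M) (\<lambda>x. \<bar>f x * ?L x\<bar>)"
      using assms(3,4) by (intro integrable_abs integrable_mult_of_square)
        (auto simp: square_integrable_def)
    show "AE x in completion M. (\<lambda>n. \<phi> n x * ?L x) \<longlonglongrightarrow> f x * ?L x"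
      by (intro AE_I2 tendsto_intros lim)
    show "AE x in completion M. norm (\<phi> n x * ?L x) \<le> \<bar>f x * ?L x\<bar>" for n
      using abs_truncation_le_abs[OF a0' ab]
      by (intro AE_I2) (auto simp: \<phi>_def abs_mult intro!: mult_right_mono)
  qed auto
  moreover have "(\<lambda>n. (1 / 2) * (\<integral> (x, y). (\<phi> n x - \<phi> n y) * (f x - f y) \<partial>\<rho>))
      \<longlonglongrightarrow> (1 / 2) * (\<integral> (x, y). (f x - f y)\<^sup>2 \<partial>\<rho>)"
    unfolding split_beta'
  proof (intro tendsto_mult_left
      integral_dominated_convergence[where w = "\<lambda>p. (f (fst p) - f (snd p))\<^sup>2"])
    show "integrable \<rho> (\<lambda>p. (f (fst p) - f (snd p))\<^sup>2)"
      by (rule energy_spaceD(2)[OF assms(2)])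
    show "AE p in \<rho>. (\<lambda>n. (\<phi> n (fst p) - \<phi> n (snd p)) * (f (fst p) - f (snd p)))
        \<longlonglongrightarrow> (f (fst p) - f (snd p))\<^sup>2"
      unfolding power2_eq_square by (intro AE_I2 tendsto_intros lim)
    show "AE p in \<rho>. norm ((\<phi> n (fst p) - \<phi> n (snd p)) * (f (fst p) - f (snd p)))
        \<le> (f (fst p) - f (snd p))\<^sup>2" for n
    proof (intro AE_I2)
      fix p
      have "\<bar>\<phi> n (fst p) - \<phi> n (snd p)\<bar> * \<bar>f (fst p) - f (snd p)\<bar>
          \<le> \<bar>f (fst p) - f (snd p)\<bar> * \<bar>f (fst p) - f (snd p)\<bar>"
        unfolding \<phi>_def by (intro mult_right_mono truncation_lipschitz a0' ab) auto
      then show "norm ((\<phi> n (fst p) - \<phi> n (snd p)) * (f (fst p) - f (snd p)))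
          \<le> (f (fst p) - f (snd p))\<^sup>2"
        by (simp add: abs_mult power2_eq_square)
    qed
  qed (unfold measurable_rho_eq, measurable)
  ultimately have "(1 / 2) * (\<integral> (x, y). (f x - f y)\<^sup>2 \<partial>\<rho>)
      = (\<integral> x. f x * ?L x \<partial>completion M)"
    unfolding green by (rule LIMSEQ_unique[rotated])
  moreover have "0 \<le> (\<integral> (x, y). (f x - f y)\<^sup>2 \<partial>\<rho>)"
    by (rule Bochner_Integration.integral_nonneg) auto
  ultimately show ?thesis
    by (simp add: energy_norm_def)
qed

end
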